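(* Let $\boldsymbol{v}$ be the binary Van der Corput sequence, considered as a sequence of cuts of a circle of unit circumference. For each integer $r\geqslant1$ and each integer $h\geqslant0$ with $h\geqslant\log_2 r$, we have $\mu_r(\boldsymbol{v})=\mu_r^{\varphi^h}$, where $\varphi^h$ is the recipe of length $2^h$ given by $\varphi^h_i=2^hv_i+1$ for $1\leqslant i\leqslant 2^h$.
   Context: Let $\boldsymbol{a}=(a_i)_{i=1}^\infty$ be an infinite sequence of points on a circle, called cuts. The first $n$ cuts divide the circle into $n$ pieces (arcs between cyclically adjacent cuts), whose sizes are their lengths. For fixed $r\geqslant1$, a portion is a set of $r$ (cyclically) consecutive pieces, and its size is the sum of the sizes of its pieces. Let $\mu^r_n(\boldsymbol{a})$ be the ratio between the maximum and minimum sizes of a portion after the first $n$ cuts (only large $n$ matter), and let $\mu_r(\boldsymbol{a})=\limsup_{n\to\infty}\mu^r_n(\boldsymbol{a})$. The binary Van der Corput sequence $\boldsymbol{v}=(v_i)_{i=1}^\infty$ is the sequence in $[0,1)$ in which $v_i$ is obtained by reversing the binary expansion of $i-1$ about the binary point: if $i-1=\sum_{k\geqslant0}b_k2^k$ with $b_k\in\{0,1\}$, then $v_i=\sum_{k\geqslant0}b_k2^{-k-1}$. Thus it begins $0,\frac12,\frac14,\frac34,\frac18,\frac58,\frac38,\frac78,\ldots$. The points $v_i$ are regarded as points of the circle $\mathbb{R}/\mathbb{Z}$. A recipe of length $p\geqslant1$ is a permutation $\sigma=\sigma_1\sigma_2\ldots\sigma_p$ of $\{1,\ldots,p\}$. It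 defines a sequence of cuts $\boldsymbol{a}_\sigma$ as follows. Step 1. Cut the circle into $p$ equally-sized pieces (in any order; the order does not affect $\mu_r(\boldsymbol{a}_\sigma)$). Let $m=1$. Step 2. At this point there are $mp$ equal ("large") pieces. Consider them, in cyclic order from a fixed starting cut, as $m$ consecutive periods, each consisting of $p$ consecutive large pieces. In turn for each $i=1,\ldots,p$, and for each such $i$ in turn for each $j=1,\ldots,m$: bisect the $\sigma_i$-th of the (original) large pieces in the $j$-th period, by a cut at its midpoint, creating two adjacent small pieces of half the size. Step 3. After every large piece has been bisected there are $2mp$ equal pieces. Replace $m$ by $2m$ and repeat Step 2, and so on forever. Write $\mu_r^\sigma=\mu_r(\boldsymbol{a}_\sigma)$. For example, $\varphi^3=15372648$. *)

theory Defs
  imports "HOL-Analysis.Analysis" "HOL-Combinatorics.Multiset_Permutations"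
begin

text \<open>
  The circle of unit circumference is the reals modulo 1. A sequence of cuts is a function
  \<open>a :: nat \<Rightarrow> real\<close> whose values \<open>a 1, a 2, \<dots>\<close> represent points of the circle (\<open>a 0\<close> is never
  used). The definitions are meant for sequences of cuts that are pairwise distinct modulo 1, for
  which the first \<open>n\<close> cuts make \<open>n\<close> pieces.
\<close>

definition cut_points :: "(nat \<Rightarrow> real) \<Rightarrow> nat \<Rightarrow> real list" where
  "cut_points a n = sorted_list_of_set ((\<lambda>i. frac (a i)) ` {1..n})"

text \<open>The sizes of the pieces in cyclic order; the last piece runs through the point 0.\<close>

definition pieces :: "(nat \<Rightarrow> real) \<Rightarrow> nat \<Rightarrow> real list" where
  "pieces a n =
     (let xs = cut_points a n in map2 (\<lambda>x y. y - x) xs (tl xs @ [hd xs + 1]))"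

text \<open>
  A portion is a set of indices into a cyclic list of \<open>N\<close> pieces, namely of \<open>r\<close> consecutive ones.
  This is as intended for \<open>N \<ge> r\<close>; for smaller \<open>N\<close> it is the whole circle.
\<close>

definition portions :: "nat \<Rightarrow> nat \<Rightarrow> nat set set" where
  "portions r N = {(\<lambda>j. (k + j) mod N) ` {..<r} |k. k < N}"

definition portion_size :: "(nat \<Rightarrow> real) \<Rightarrow> nat \<Rightarrow> nat set \<Rightarrow> real" where
  "portion_size a n P = (\<Sum>k\<in>P. pieces a n ! k)"

definition mu_upto :: "nat \<Rightarrow> (nat \<Rightarrow> real) \<Rightarrow> nat \<Rightarrow> real" where
  "mu_upto r a n =
     (let S = portion_size a n ` portions r (length (pieces a n)) in Max S / Min S)"

definition mu :: "nat \<Rightarrow> (nat \<Rightarrow> real) \<Rightarrow> ereal" where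
  "mu r a = limsup (\<lambda>n. ereal (mu_upto r a n))"

definition van_der_corput :: "nat \<Rightarrow> real" where
  "van_der_corput i = (\<Sum>k. of_bool (bit (i - 1) k) * (1 / 2) ^ (k + 1))"

definition recipe :: "nat \<Rightarrow> nat list \<Rightarrow> bool" where
  "recipe p \<sigma> \<longleftrightarrow> p \<ge> 1 \<and> \<sigma> \<in> permutations_of_set {1..p}"

text \<open>
  The cuts made when every one of \<open>m * p\<close> equal pieces, \<open>p = length \<sigma>\<close>, is bisected. With pieces
  and periods counted from 1, the \<open>s\<close>-th piece of the \<open>j\<close>-th period is piece number
  \<open>(j - 1) * p + s\<close> on the circle, and piece number \<open>q\<close> is \<open>{(q - 1) / (m * p)..q / (m * p)}\<close>.
\<close>

definition bisecting_cuts :: "nat list \<Rightarrow> nat \<Rightarrow> real list" where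
  "bisecting_cuts \<sigma> m =
     [(real ((j - 1) * length \<sigma> + s) - 1 / 2) / real (m * length \<sigma>). s \<leftarrow> \<sigma>, j \<leftarrow> [1..<m + 1]]"

text \<open>
  The cuts made until there are \<open>2 ^ t * p\<close> equal pieces. The \<open>p\<close> initial cuts are made in
  increasing order.
\<close>

primrec cuts_until :: "nat list \<Rightarrow> nat \<Rightarrow> real list" where
  "cuts_until \<sigma> 0 = [real k / real (length \<sigma>). k \<leftarrow> [0..<length \<sigma>]]"
| "cuts_until \<sigma> (Suc t) = cuts_until \<sigma> t @ bisecting_cuts \<sigma> (2 ^ t)"

text \<open>
  The lists \<open>cuts_until \<sigma> t\<close> extend one another, and \<open>cuts_until \<sigma> i\<close> is long enough to contain
  the \<open>i\<close>-th cut.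
\<close>

definition recipe_cuts :: "nat list \<Rightarrow> nat \<Rightarrow> real" where
  "recipe_cuts \<sigma> i = cuts_until \<sigma> i ! (i - 1)"

definition mu_recipe :: "nat \<Rightarrow> nat list \<Rightarrow> ereal" where
  "mu_recipe r \<sigma> = mu r (recipe_cuts \<sigma>)"

definition phi :: "nat \<Rightarrow> nat list" where
  "phi h = [nat \<lfloor>2 ^ h * van_der_corput i\<rfloor> + 1. i \<leftarrow> [1..<2 ^ h + 1]]"


subsection \<open>Well-definedness\<close>

lemma length_bisecting_cuts: "length (bisecting_cuts \<sigma> m) = m * length \<sigma>"
  by (simp add: bisecting_cuts_def length_concat o_def sum_list_triv)

lemma length_cuts_until: "length (cuts_until \<sigma> t) = 2 ^ t * length \<sigma>"
  by (induction t) (simp_all add: length_bisecting_cuts)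

lemma cuts_until_nth:
  assumes "t \<le> u" "q < 2 ^ t * length \<sigma>"
  shows "cuts_until \<sigma> u ! q = cuts_until \<sigma> t ! q"
  using assms
proof (induction u rule: dec_induct)
  case (step u)
  have "2 ^ t * length \<sigma> \<le> 2 ^ u * length \<sigma>"
    using step.hyps by (intro mult_le_mono1 power_increasing) auto
  then have "q < length (cuts_until \<sigma> u)"
    using step.prems unfolding length_cuts_until by linarith
  then show ?case
    using step by (simp add: nth_append)
qed simp

lemma recipe_cuts_eq:
  assumes "\<sigma> \<noteq> []" "1 \<le> i" "i \<le> 2 ^ t * length \<sigma>"
  shows "recipe_cuts \<sigma> i = cuts_until \<sigma> t ! (i - 1)"
proof -
  have "i < 2 ^ i * length \<sigma>"
    using assms(1) less_exp[of i] by (cases \<sigma>) (auto intro: trans_less_add1)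
  then show ?thesis
    using assms cuts_until_nth[of i t "i - 1" \<sigma>] cuts_until_nth[of t i "i - 1" \<sigma>]
    unfolding recipe_cuts_def by (cases "i \<le> t") auto
qed

text \<open>The order of finitely many initial cuts does not matter.\<close>

lemma mu_cong:
  assumes same: "a ` {1..p} = b ` {1..p}" and later: "\<And>i. i > p \<Longrightarrow> a i = b i"
  shows "mu r a = mu r b"
proof -
  have "mu_upto r a n = mu_upto r b n" if "n \<ge> p" for n
  proof -
    have "{1..n} = {1..p} \<union> {p<..n}"
      using that by auto
    then have "a ` {1..n} = b ` {1..n}"
      using same later by (simp add: image_Un)
    then have "(\<lambda>i. frac (a i)) ` {1..n} = (\<lambda>i. frac (b i)) ` {1..n}"
      by (metis image_image)
    then show ?thesis
      by (simp add: mu_upto_def portion_size_def pieces_def cut_points_def)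
  qed
  then show ?thesis
    unfolding mu_def by (intro Limsup_eq) (auto simp: eventually_sequentially)
qed

lemma van_der_corput_scaled:
  assumes "1 \<le> i" "i \<le> 2 ^ h"
  shows "2 ^ h * van_der_corput i =
    real (horner_sum of_bool 2 (map (\<lambda>k. bit (i - 1) (h - 1 - k)) [0..<h]))"
proof -
  have bits: "\<not> bit (i - 1) k" if "k \<ge> h" for k
  proof -
    have "i - 1 < 2 ^ h"
      using assms by linarith
    also have "(2::nat) ^ h \<le> 2 ^ k"
      using that by (simp add: power_increasing)
    finally show ?thesis
      unfolding bit_iff_odd by simp
  qed
  have "van_der_corput i = (\<Sum>k<h. of_bool (bit (i - 1) k) * (1 / 2) ^ (k + 1))"
    unfolding van_der_corput_def by (rule suminf_finite) (use bits in \<open>auto simp: not_less\<close>)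
  then have "2 ^ h * van_der_corput i = (\<Sum>k<h. of_bool (bit (i - 1) k) * 2 ^ (h - Suc k))"
    by (auto simp: sum_distrib_left power_diff power_divide intro!: sum.cong)
  also have "\<dots> = (\<Sum>k<h. of_bool (bit (i - 1) (h - Suc k)) * 2 ^ k)"
    by (subst sum.nat_diff_reindex[symmetric]) (auto intro!: sum.cong simp: Suc_diff_Suc)
  finally show ?thesis
    by (simp add: horner_sum_eq_sum lessThan_atLeast0)
qed

lemma phi_nth:
  assumes "1 \<le> i" "i \<le> 2 ^ h"
  shows "real (phi h ! (i - 1)) = 2 ^ h * van_der_corput i + 1"
proof -
  have "phi h ! (i - 1) = nat \<lfloor>2 ^ h * van_der_corput i\<rfloor> + 1"
    using assms nth_upt[of 1 "i - 1" "2 ^ h + 1"] by (simp add: phi_def del: upt_Suc)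
  then show ?thesis
    by (simp add: van_der_corput_scaled[OF assms])
qed

lemma recipe_phi: "recipe (2 ^ h) (phi h)"
proof -
  let ?R = "\<lambda>i. horner_sum of_bool (2::nat) (map (\<lambda>k. bit (i - 1) (h - 1 - k)) [0..<h])"
  have phi: "phi h = map (\<lambda>i. ?R i + 1) [1..<2 ^ h + 1]"
    by (auto simp: phi_def van_der_corput_scaled simp del: upt_Suc)
  have inj: "inj_on ?R {1..(2::nat) ^ h}"
  proof (rule inj_onI)
    fix i j :: nat assume ij: "i \<in> {1..2 ^ h}" "j \<in> {1..2 ^ h}" and eq: "?R i = ?R j"
    have *: "take_bit h (l - 1) = l - 1" if "l \<in> {1..2 ^ h}" for l :: nat
      using that by (auto intro!: take_bit_nat_eq_self)
    have "bit (i - 1) k = bit (j - 1) k" if "k < h" for k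
      using arg_cong[OF eq, of "\<lambda>x. bit x (h - 1 - k)"] that
      by (simp add: bit_horner_sum_bit_iff)
    then have "take_bit h (i - 1) = take_bit h (j - 1)"
      by (intro bit_eqI) (auto simp: bit_take_bit_iff)
    then show "i = j"
      using ij *[of i] *[of j] by auto
  qed
  have sub: "(\<lambda>i. ?R i + 1) ` {1..(2::nat) ^ h} \<subseteq> {1..2 ^ h}"
  proof -
    have "?R i < 2 ^ h" for i
      using horner_sum_of_bool_2_less[of "map (\<lambda>k. bit (i - 1) (h - 1 - k)) [0..<h]"]
      by simp
    then have "?R i + 1 \<in> {1..2 ^ h}" for i
      by (metis Suc_eq_plus1 Suc_leI atLeastAtMost_iff le_add2)
    then show ?thesis
      by blast
  qed
  have inj': "inj_on (\<lambda>i. ?R i + 1) {1..(2::nat) ^ h}"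
    using inj by (auto simp: inj_on_def)
  have set: "set [1..<2 ^ h + 1] = {1..(2::nat) ^ h}"
    by (auto simp del: upt_Suc)
  have "distinct (phi h)"
    unfolding phi distinct_map set using inj' by simp
  moreover have "set (phi h) = {1..2 ^ h}"
    unfolding phi set_map set by (rule endo_inj_surj[OF _ sub inj']) simp
  ultimately show ?thesis
    by (simp add: recipe_def permutations_of_set_def)
qed

end

theory Submission
  imports Defs
begin

text \<open>
  Put \<open>p = 2 ^ h\<close> and let \<open>m * p\<close> be a power of two. Both sequences first make all multiples of
  \<open>1 / (m * p)\<close> and then bisect, for each residue \<open>\<phi>\<^sub>i\<close> modulo \<open>p\<close> in turn, the pieces with that
  residue; they differ only in the order in which the \<open>m\<close> periods are visited. Since \<open>r \<le> p\<close>, a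
  portion meets at most \<open>p\<close> consecutive large pieces, hence only one piece of the residue
  currently processed. So the set of portion sizes depends only on whether a
  processed and an unprocessed period exist, that is, on the number of cuts and not on the order.
\<close>

section \<open>Portion sizes as differences in the lifted cut set\<close>

lemma mod_add_lcancel_nat:
  fixes k x y N :: nat
  assumes "(k + x) mod N = (k + y) mod N" "x < N" "y < N"
  shows "x = y"
proof -
  have *: "x = y" if "(k + y) mod N = (k + x) mod N" "x \<le> y" "y < N" for x y
  proof -
    have "N dvd y - x" using that mod_eq_dvd_iff_nat[of "k + x" "k + y" N] by simp
    then show ?thesis
      using that by (meson diff_is_0_eq dvd_imp_le le_antisym less_imp_diff_less not_le
          zero_less_iff_neq_zero)
  qed
  show ?thesis
    using *[of x y] *[of y x] assms by (metis nat_le_linear)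
qed

text \<open>A one-sided lift of the circle to the half-line: translating by naturals only lets the
  points be enumerated in increasing order by \<open>nat\<close>, and every portion still occurs
  without wrapping around.\<close>

definition unrolled :: "real set \<Rightarrow> real set" where
  "unrolled A = {x + real q |x q. x \<in> A}"

text \<open>A portion telescopes to the difference of two lifted points, and \<open>r\<close> is the
  number of lifted points from the first up to but excluding the second. This removes the cyclic
  indices: only the set of cut points matters. The bound \<open>r \<le> card A\<close> keeps a
  portion from overlapping itself.\<close>

lemma portion_sizes_eq:
  fixes a :: "nat \<Rightarrow> real" and n r :: nat
  defines "A \<equiv> (\<lambda>i. frac (a i)) ` {1..n}"
  assumes "1 \<le> r" and r: "r \<le> card A"
  shows "portion_size a n ` portions r (length (pieces a n)) =
    {y - x |x y. x \<in> unrolled A \<and> y \<in> unrolled A \<and> x \<le> y \<and> card (unrolled A \<inter> {x..<y}) = r}"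
    (is "?L = ?R")
proof -
  define xs where "xs = sorted_list_of_set A"
  define N where "N = card A"
  have fin: "finite A" by (simp add: A_def)
  have len: "length xs = N" by (simp add: xs_def N_def)
  have N: "0 < N" "r \<le> N" using assms by (auto simp: N_def)
  have set: "set xs = A" using fin by (simp add: xs_def)
  have srt: "xs ! i < xs ! j" if "i < j" "j < N" for i j
    using strict_sorted_list_of_set[of A] that len
    by (auto simp: xs_def sorted_wrt_iff_nth_less)
  have range01: "0 \<le> xs ! i" "xs ! i < 1" if "i < N" for i
    using nth_mem[of i xs] that len set by (auto simp: A_def frac_lt_1)
  \<comment> \<open>\<open>X\<close> will be the increasing enumeration of the lift; advancing by
    \<open>N\<close> steps is one full turn.\<close>
  define X where "X i = xs ! (i mod N) + real (i div N)" for i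
  have X_add: "X (i + q * N) = X i + real q" for i q
    using N by (simp add: X_def)
  have "X i < X (Suc i)" for i
  proof (cases "Suc (i mod N) = N")
    \<comment> \<open>The step from the last point of one turn to the first of the next: the former
      is below 1 and the latter is at least 1 before adding the common number of turns.\<close>
    case True
    then show ?thesis
      using N range01(2)[of "i mod N"] range01(1)[of 0]
      by (simp add: X_def mod_Suc div_Suc)
  next
    case False
    then have "Suc (i mod N) < N" using N by (meson Suc_lessI mod_less_divisor)
    then show ?thesis
      using False srt[of "i mod N" "Suc (i mod N)"] by (simp add: X_def mod_Suc div_Suc)
  qed
  then have mono: "strict_mono X" by (simp add: strict_mono_Suc_iff)
  have ranX: "range X = unrolled A"
  proof (intro equalityI subsetI)
    fix y assume "y \<in> range X"
    then obtain i where i: "y = X i" by auto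
    have "xs ! (i mod N) \<in> A" using N len set by (metis mod_less_divisor nth_mem)
    then show "y \<in> unrolled A" unfolding unrolled_def i X_def by blast
  next
    fix y assume "y \<in> unrolled A"
    then obtain x q where y: "y = x + real q" "x \<in> A" by (auto simp: unrolled_def)
    then obtain i where i: "i < N" "x = xs ! i" using set len by (metis in_set_conv_nth)
    have "y = X (i + q * N)" using i y unfolding X_add by (simp add: X_def)
    then show "y \<in> range X" by blast
  qed
  have cnt: "card (unrolled A \<inter> {X i..<X j}) = j - i" for i j
  proof -
    have "unrolled A \<inter> {X i..<X j} = X ` {i..<j}"
      unfolding ranX[symmetric]
      by (auto simp: strict_mono_less_eq[OF mono] strict_mono_less[OF mono])
    then show ?thesis
      using strict_mono_imp_inj_on[OF mono] by (simp add: card_image inj_on_subset)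
  qed
  have pcs: "pieces a n = map2 (\<lambda>x y. y - x) xs (tl xs @ [hd xs + 1])"
    by (simp add: pieces_def cut_points_def xs_def A_def Let_def)
  have lenp: "length (pieces a n) = N" using len N by (simp add: pcs)
  have piece: "pieces a n ! k = X (Suc k) - X k" if k: "k < N" for k
  proof (cases "Suc k < N")
    case True
    then have "k < length (tl xs)" using len by simp
    then show ?thesis using True k len by (simp add: pcs X_def nth_append nth_tl)
  next
    case False
    then have "Suc k = N" using k by simp
    moreover have "xs \<noteq> []" using len N by auto
    ultimately show ?thesis using k len
      by (auto simp: pcs X_def nth_append hd_conv_nth)
  qed
  have piece_mod: "pieces a n ! (i mod N) = X (Suc i) - X i" for i
    using piece[of "i mod N"] X_add[of "i mod N" "i div N"] X_add[of "Suc (i mod N)" "i div N"] N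
    by simp
  \<comment> \<open>Since \<open>r \<le> N\<close>, the \<open>r\<close> indices are distinct, so
    the sum over the index set is the sum over \<open>j < r\<close>.\<close>
  have inj: "inj_on (\<lambda>j. (k + j) mod N) {..<r}" for k
  proof (rule inj_onI)
    fix x y assume *: "x \<in> {..<r}" "y \<in> {..<r}" "(k + x) mod N = (k + y) mod N"
    then show "x = y" using N by (intro mod_add_lcancel_nat[of k x N y]) auto
  qed
  have portion: "portion_size a n ((\<lambda>j. (k + j) mod N) ` {..<r}) = X (k + r) - X k" for k
    unfolding portion_size_def
    using inj[of k]
    by (simp add: sum.reindex piece_mod sum_lessThan_telescope[of "\<lambda>j. X (k + j)", simplified])
  have L: "?L = {X (k + r) - X k |k. k < N}"
    by (simp only: portions_def lenp setcompr_eq_image image_image portion)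
  show ?thesis
  proof (intro equalityI subsetI)
    fix d assume "d \<in> ?L"
    then obtain k where k: "d = X (k + r) - X k" unfolding L by blast
    have "X k \<le> X (k + r)" by (simp add: strict_mono_less_eq[OF mono])
    moreover have "card (unrolled A \<inter> {X k..<X (k + r)}) = r" by (simp add: cnt)
    ultimately show "d \<in> ?R" using ranX k by blast
  next
    fix d assume "d \<in> ?R"
    then obtain i j where d: "d = X j - X i" "card (unrolled A \<inter> {X i..<X j}) = r"
      unfolding ranX[symmetric] by blast
    \<comment> \<open>The count gives \<open>j - i = r\<close> with truncated subtraction;
      \<open>1 \<le> r\<close> rules out \<open>j < i\<close>.\<close>
    then have j: "j = i + r" using \<open>1 \<le> r\<close> unfolding cnt by simp
    have "d = X (i mod N + r) - X (i mod N)"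
      using X_add[of "i mod N" "i div N"] X_add[of "i mod N + r" "i div N"] d(1) j
      by (simp add: ac_simps)
    moreover have "i mod N < N" using N by simp
    ultimately show "d \<in> ?L" unfolding L by blast
  qed
qed

section \<open>Gaps in the half-piece grid\<close>

text \<open>
  In units of half a large piece, even numbers are the ends of large pieces and \<open>2 * q + 1\<close> is the
  midpoint of the large piece \<open>q\<close>, counted from 0; \<open>D\<close> contains the pieces already bisected.
\<close>

definition half_grid :: "nat set \<Rightarrow> nat set" where
  "half_grid D = {c. even c \<or> c div 2 \<in> D}"

text \<open>The integer counterpart of the right-hand side of
  \<open>portion_sizes_eq\<close>.\<close>

definition gaps :: "nat \<Rightarrow> nat set \<Rightarrow> nat set" where
  "gaps r C = {c' - c |c c'. c \<in> C \<and> c' \<in> C \<and> c \<le> c' \<and> card (C \<inter> {c..<c'}) = r}"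

lemma unrolled_gaps:
  assumes A: "unrolled A = (\<lambda>c. real c / L) ` C" and L: "0 < L"
  shows "{y - x |x y. x \<in> unrolled A \<and> y \<in> unrolled A \<and> x \<le> y \<and> card (unrolled A \<inter> {x..<y}) = r}
    = (\<lambda>d. real d / L) ` gaps r C" (is "?L = ?R")
proof -
  have cnt: "card (unrolled A \<inter> {real c / L..<real c' / L}) = card (C \<inter> {c..<c'})" for c c'
  proof -
    have "unrolled A \<inter> {real c / L..<real c' / L} = (\<lambda>c. real c / L) ` (C \<inter> {c..<c'})"
      unfolding A using L by (auto simp: divide_le_cancel divide_less_cancel)
    moreover have "inj (\<lambda>c. real c / L)" using L by (auto simp: inj_def)
    ultimately show ?thesis by (simp add: card_image inj_on_subset)
  qed
  have le: "real c / L \<le> real c' / L \<longleftrightarrow> c \<le> c'" for c c'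
    using L by (simp add: divide_le_cancel)
  show ?thesis
  proof (intro equalityI subsetI)
    fix d assume "d \<in> ?L"
    then obtain x y where xy: "d = y - x" "x \<in> unrolled A" "y \<in> unrolled A" "x \<le> y"
      "card (unrolled A \<inter> {x..<y}) = r" by blast
    then obtain c c' where c: "x = real c / L" "y = real c' / L" "c \<in> C" "c' \<in> C"
      unfolding A by blast
    have d: "d = real c' / L - real c / L" "c \<in> C" "c' \<in> C" "c \<le> c'"
      "card (C \<inter> {c..<c'}) = r"
      using xy(1,4,5) c(3,4) unfolding c(1,2) cnt le by simp_all
    then have "c' - c \<in> gaps r C" "d = real (c' - c) / L"
      by (auto simp: gaps_def of_nat_diff diff_divide_distrib)
    then show "d \<in> ?R" by blast
  next
    fix d assume "d \<in> ?R"
    then obtain c c' where d: "d = real (c' - c) / L" "c \<in> C" "c' \<in> C" "c \<le> c'"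
      "card (C \<inter> {c..<c'}) = r"
      unfolding gaps_def by blast
    then have "d = real c' / L - real c / L" by (simp add: of_nat_diff diff_divide_distrib)
    moreover have "real c / L \<in> unrolled A" "real c' / L \<in> unrolled A"
      using d(2,3) unfolding A by blast+
    moreover have "real c / L \<le> real c' / L" "card (unrolled A \<inter> {real c / L..<real c' / L}) = r"
      unfolding le cnt by (fact d)+
    ultimately show "d \<in> ?L" by blast
  qed
qed

text \<open>The points \<open>c\<close>, \<open>c + 2\<close>, ..., \<open>c + 2 * (k - 1)\<close>
  are ends of large pieces, hence present for every \<open>D\<close>. Only the last has to stay
  below \<open>c'\<close>, which explains the slack of 1.\<close>

lemma card_evens_ge: "c + 2 * k \<le> c' + 1 \<Longrightarrow> even c \<Longrightarrow> k \<le> card (half_grid D \<inter> {c..<c'})"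
proof -
  assume *: "c + 2 * k \<le> c' + 1" "even c"
  have "(\<lambda>j. c + 2 * j) ` {..<k} \<subseteq> half_grid D \<inter> {c..<c'}"
    using * by (auto simp: half_grid_def)
  then have "card ((\<lambda>j. c + 2 * j) ` {..<k}) \<le> card (half_grid D \<inter> {c..<c'})"
    by (intro card_mono) auto
  then show ?thesis by (simp add: card_image inj_on_def)
qed

text \<open>Every large piece contributes at least its left end, so few points cannot span many
  pieces. For odd \<open>c\<close> the even points alone give just \<open>p\<close>, and
  \<open>c\<close> itself is the extra one that yields the contradiction.\<close>

lemma half_grid_span:
  assumes "c \<in> half_grid D" "c \<le> c'" and r: "card (half_grid D \<inter> {c..<c'}) \<le> p" and "1 \<le> p"
  shows "c' \<le> 2 * (c div 2 + p)"
proof (rule ccontr)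
  assume "\<not> ?thesis"
  then have c': "2 * (c div 2) + 2 * p + 1 \<le> c'" by simp
  show False
  proof (cases "even c")
    case True
    then have "Suc p \<le> card (half_grid D \<inter> {c..<c'})"
      using c' by (intro card_evens_ge) auto
    then show False using r by simp
  next
    case False
    have "p \<le> card (half_grid D \<inter> {Suc c..<c'})"
      using c' False by (intro card_evens_ge) auto
    also have "\<dots> < card (half_grid D \<inter> {c..<c'})"
    proof (rule psubset_card_mono)
      have "c \<in> half_grid D \<inter> {c..<c'}" using assms(1) c' False \<open>1 \<le> p\<close> by (auto elim!: oddE)
      moreover have "c \<notin> half_grid D \<inter> {Suc c..<c'}" by simp
      ultimately have "half_grid D \<inter> {Suc c..<c'} \<noteq> half_grid D \<inter> {c..<c'}" by blast
      then show "half_grid D \<inter> {Suc c..<c'} \<subset> half_grid D \<inter> {c..<c'}" by auto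
    qed simp
    finally show False using r by simp
  qed
qed

text \<open>By \<open>half_grid_span\<close> a gap consults \<open>D\<close> only on a window of
  \<open>p\<close> consecutive large pieces. If every such window of \<open>D\<close> reappears
  translated in \<open>D'\<close>, so does every gap, with its length and point count.\<close>

lemma gaps_subset:
  assumes r: "r \<le> p" "1 \<le> p"
    and shift: "\<And>b. \<exists>k. \<forall>q\<in>{b..<b + p}. q \<in> D \<longleftrightarrow> q + k \<in> D'"
  shows "gaps r (half_grid D) \<subseteq> gaps r (half_grid D')"
proof
  fix d assume "d \<in> gaps r (half_grid D)"
  then obtain c c' where d: "d = c' - c" "c \<in> half_grid D" "c' \<in> half_grid D" "c \<le> c'"
    "card (half_grid D \<inter> {c..<c'}) = r"
    by (auto simp: gaps_def)
  have span: "c' \<le> 2 * (c div 2 + p)"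
    by (rule half_grid_span[OF d(2,4) _ r(2)]) (use d r in simp)
  obtain k where k: "\<forall>q\<in>{c div 2..<c div 2 + p}. q \<in> D \<longleftrightarrow> q + k \<in> D'"
    using shift by blast
  have eq: "e \<in> half_grid D \<longleftrightarrow> e + 2 * k \<in> half_grid D'" if "c \<le> e" "e \<le> c'" for e
  proof (cases "even e")
    case False
    \<comment> \<open>The right end \<open>c'\<close> may be even and lie just past the window, but
      even points do not consult \<open>D\<close>; odd ones stay inside.\<close>
    have "e div 2 \<in> {c div 2..<c div 2 + p}"
      using that span False by (auto elim!: oddE)
    then show ?thesis using k False by (simp add: half_grid_def add.commute)
  qed (simp add: half_grid_def)
  have "half_grid D' \<inter> {c + 2 * k..<c' + 2 * k} = (\<lambda>e. e + 2 * k) ` (half_grid D \<inter> {c..<c'})"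
  proof (intro equalityI subsetI)
    fix e assume e: "e \<in> half_grid D' \<inter> {c + 2 * k..<c' + 2 * k}"
    then have "e - 2 * k \<in> half_grid D \<inter> {c..<c'}" "e = (e - 2 * k) + 2 * k"
      using eq[of "e - 2 * k"] by auto
    then show "e \<in> (\<lambda>e. e + 2 * k) ` (half_grid D \<inter> {c..<c'})" by blast
  qed (use eq in auto)
  then have "card (half_grid D' \<inter> {c + 2 * k..<c' + 2 * k}) = r"
    using d(5) by (simp add: card_image)
  moreover have "c + 2 * k \<in> half_grid D'" "c' + 2 * k \<in> half_grid D'" using eq d by auto
  moreover have "d = (c' + 2 * k) - (c + 2 * k)" "c + 2 * k \<le> c' + 2 * k" using d by auto
  ultimately show "d \<in> gaps r (half_grid D')" unfolding gaps_def by blast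
qed

section \<open>Processed pieces up to translation\<close>

text \<open>\<open>E\<close> holds the finished residues, \<open>s\<close> is the residue in
  progress and \<open>J\<close> the periods already visited for it. Reducing the period modulo
  \<open>m\<close> makes the set periodic with period \<open>m * p\<close>, as the lifted circle
  requires.\<close>

definition bisected :: "nat \<Rightarrow> nat \<Rightarrow> nat set \<Rightarrow> nat \<Rightarrow> nat set \<Rightarrow> nat set" where
  "bisected m p E s J = {q. q mod p \<in> E \<or> q mod p = s \<and> q div p mod m \<in> J}"

text \<open>The window contains exactly one piece \<open>q0\<close> of residue \<open>s\<close>, and
  shifts by multiples of \<open>p\<close> preserve residues. So it suffices to move the period of
  \<open>q0\<close> to one with the same status in \<open>J'\<close>. Equal cardinalities provide
  it: \<open>J'\<close> is nonempty if \<open>J\<close> is, and misses a period if \<open>J\<close>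
  does.\<close>

lemma bisected_shift:
  assumes "0 < p" "0 < m" "s < p" "J \<subseteq> {..<m}" "J' \<subseteq> {..<m}" and card: "card J = card J'"
  shows "\<exists>k. \<forall>q\<in>{b..<b + p}. q \<in> bisected m p E s J \<longleftrightarrow> q + k \<in> bisected m p E s J'"
proof -
  \<comment> \<open>The first number from \<open>b\<close> on with residue \<open>s\<close>;
    \<open>p - b mod p\<close> acts as the negative of \<open>b\<close> modulo
    \<open>p\<close>.\<close>
  define q0 where "q0 = b + (s + (p - b mod p)) mod p"
  have "q0 mod p = s"
  proof -
    have "q0 mod p = (b mod p + (s + (p - b mod p))) mod p" by (simp add: q0_def mod_simps)
    also have "b mod p + (s + (p - b mod p)) = s + p"
      using mod_less_divisor[OF \<open>0 < p\<close>, of b] by linarith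
    finally show ?thesis using assms by simp
  qed
  have q0: "q = q0" if "q \<in> {b..<b + p}" "q mod p = s" for q
  proof -
    have "(b + (q - b)) mod p = (b + (q0 - b)) mod p"
      using that \<open>q0 mod p = s\<close> by (simp add: q0_def)
    moreover have "q - b < p" "q0 - b < p" using that \<open>0 < p\<close> by (auto simp: q0_def)
    ultimately have "q - b = q0 - b" by (rule mod_add_lcancel_nat)
    moreover have "b \<le> q" "b \<le> q0" using that by (auto simp: q0_def)
    ultimately show ?thesis by simp
  qed
  have "finite J" "finite J'" using assms finite_subset by blast+
  have "\<exists>u<m. u \<in> J' \<longleftrightarrow> q0 div p mod m \<in> J"
  proof (cases "q0 div p mod m \<in> J")
    case True
    then have "J' \<noteq> {}" using card \<open>finite J\<close> by auto
    then show ?thesis using True assms by blast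
  next
    case False
    have "J' \<noteq> {..<m}"
    proof
      assume "J' = {..<m}"
      then have "J = {..<m}" using card assms(4) by (intro card_subset_eq) auto
      then show False using False \<open>0 < m\<close> by simp
    qed
    then show ?thesis using False assms(5) by blast
  qed
  then obtain u where u: "u < m" "u \<in> J' \<longleftrightarrow> q0 div p mod m \<in> J" by blast
  \<comment> \<open>Adding \<open>k\<close> periods carries the period of \<open>q0\<close> to
    \<open>u\<close> modulo \<open>m\<close>; the translation itself is by
    \<open>k * p\<close>.\<close>
  define k where "k = u + (m - q0 div p mod m)"
  have "(q0 div p + k) mod m = (q0 div p mod m + k) mod m" by (simp add: mod_simps)
  also have "q0 div p mod m + k = u + m"
    unfolding k_def using mod_less_divisor[OF \<open>0 < m\<close>, of "q0 div p"] by linarith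
  finally have k: "(q0 div p + k) mod m = u" using u by simp
  have "q \<in> bisected m p E s J \<longleftrightarrow> q + k * p \<in> bisected m p E s J'" if "q \<in> {b..<b + p}" for q
    using q0[OF that] k u \<open>0 < p\<close> by (auto simp: bisected_def add.commute)
  then show ?thesis by blast
qed

section \<open>Stages of bisection\<close>

text \<open>
  \<open>\<sigma>\<close> is the recipe and \<open>\<tau>\<close> the order in which the periods are visited, both counted from 0; the
  recipe sequences have \<open>\<tau> = id\<close>, the Van der Corput sequence visits them in bit-reversed order.
\<close>

definition bisecting_stage ::
  "(nat \<Rightarrow> real) \<Rightarrow> nat \<Rightarrow> nat \<Rightarrow> (nat \<Rightarrow> nat) \<Rightarrow> (nat \<Rightarrow> nat) \<Rightarrow> bool" where
  "bisecting_stage a m p \<sigma> \<tau> \<longleftrightarrow>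
     a ` {1..m * p} = (\<lambda>k. real k / real (m * p)) ` {..<m * p} \<and>
     (\<forall>i<p. \<forall>j<m. a (m * p + (i * m + j) + 1) =
       real (2 * (\<tau> j * p + \<sigma> i) + 1) / real (2 * (m * p))) \<and>
     \<sigma> ` {..<p} \<subseteq> {..<p} \<and> bij_betw \<tau> {..<m} {..<m}"

text \<open>Splits the cuts made so far in a stage into \<open>i\<close> complete rounds of
  \<open>m\<close> cuts and \<open>j\<close> cuts of the current round.\<close>

lemma lessThan_mult_add:
  fixes i j m :: nat
  shows "{..<i * m + j} = (\<lambda>(i, j). i * m + j) ` ({..<i} \<times> {..<m}) \<union> (\<lambda>j. i * m + j) ` {..<j}"
proof (intro equalityI subsetI)
  fix x assume x: "x \<in> {..<i * m + j}"
  show "x \<in> (\<lambda>(i, j). i * m + j) ` ({..<i} \<times> {..<m}) \<union> (\<lambda>j. i * m + j) ` {..<j}"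
  proof (cases "x < i * m")
    case True
    then have "0 < m" by (cases m) auto
    with True have "(x div m, x mod m) \<in> {..<i} \<times> {..<m}"
      by (simp add: less_mult_imp_div_less)
    then show ?thesis by (intro UnI1 image_eqI[of _ _ "(x div m, x mod m)"]) auto
  next
    case False
    then show ?thesis using x by (intro UnI2 image_eqI[of _ _ "x - i * m"]) auto
  qed
next
  fix x assume "x \<in> (\<lambda>(i, j). i * m + j) ` ({..<i} \<times> {..<m}) \<union> (\<lambda>j. i * m + j) ` {..<j}"
  then show "x \<in> {..<i * m + j}"
  proof
    assume "x \<in> (\<lambda>(i, j). i * m + j) ` ({..<i} \<times> {..<m})"
    then obtain i' j' where *: "x = i' * m + j'" "i' < i" "j' < m" by auto
    then have "x < Suc i' * m" by simp
    also have "\<dots> \<le> i * m" using * by (intro mult_le_mono1) simp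
    finally show ?thesis by simp
  qed auto
qed

lemma bisected_lessThan:
  assumes "\<sigma> ` {..<p} \<subseteq> {..<p}" "bij_betw \<tau> {..<m} {..<m}" "i < p" "j < m"
  shows "{q. q < m * p} \<inter> bisected m p (\<sigma> ` {..<i}) (\<sigma> i) (\<tau> ` {..<j}) =
    (\<lambda>(i, j). \<tau> j * p + \<sigma> i) ` ({..<i} \<times> {..<m}) \<union> (\<lambda>j. \<tau> j * p + \<sigma> i) ` {..<j}"
    (is "?L = ?R")
proof (intro equalityI subsetI)
  fix q assume q: "q \<in> ?L"
  then have dm: "q div p < m" "q div p mod m = q div p"
    by (auto simp: less_mult_imp_div_less)
  show "q \<in> ?R"
  proof (cases "q mod p \<in> \<sigma> ` {..<i}")
    case True
    then obtain i' where i': "i' < i" "q mod p = \<sigma> i'" by auto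
    obtain j' where j': "j' < m" "q div p = \<tau> j'"
      using dm assms(2) unfolding bij_betw_def by (metis imageE lessThan_iff)
    have "q = \<tau> j' * p + \<sigma> i'" using i' j' by (metis div_mult_mod_eq)
    then show ?thesis using i' j' by auto
  next
    case False
    then obtain j' where j': "j' < j" "q div p = \<tau> j'" "q mod p = \<sigma> i"
      using q dm by (auto simp: bisected_def)
    have "q = \<tau> j' * p + \<sigma> i" using j' by (metis div_mult_mod_eq)
    then show ?thesis using j' by auto
  qed
next
  fix q assume "q \<in> ?R"
  then consider (1) i' j' where "q = \<tau> j' * p + \<sigma> i'" "i' < i" "j' < m"
    | (2) j' where "q = \<tau> j' * p + \<sigma> i" "j' < j" by auto
  then show "q \<in> ?L"
  proof cases
    case 1
    then have "i' < p" using assms by simp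
    then have "\<sigma> i' < p" using assms(1) by blast
    moreover have "\<tau> j' < m" using 1 assms unfolding bij_betw_def by auto
    ultimately have lt: "\<sigma> i' < p" "\<tau> j' < m" .
    then have "q < m * p"
      using 1 mult_le_mono1[of "Suc (\<tau> j')" m p] by simp
    then show ?thesis using 1 lt by (auto simp: bisected_def)
  next
    case 2
    then have lt: "\<sigma> i < p" "\<tau> j' < m"
      using assms unfolding bij_betw_def by auto
    then have "q < m * p"
      using 2 mult_le_mono1[of "Suc (\<tau> j')" m p] by simp
    then show ?thesis using 2 lt by (auto simp: bisected_def)
  qed
qed

text \<open>Translation by \<open>l\<close> on the circle is a shift by \<open>2 * l * M\<close> in
  half pieces. Even points are invariant under it, and odd ones because \<open>D\<close> has period
  \<open>M\<close>.\<close>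

lemma unrolled_half_grid:
  fixes M :: nat
  assumes M: "0 < M" and per: "\<And>q l. q + l * M \<in> D \<longleftrightarrow> q \<in> D"
  shows "unrolled ((\<lambda>k. real k / real M) ` {..<M} \<union>
      (\<lambda>q. real (2 * q + 1) / real (2 * M)) ` ({q. q < M} \<inter> D))
    = (\<lambda>c. real c / real (2 * M)) ` half_grid D" (is "unrolled ?A = ?C ` _")
proof (intro equalityI subsetI)
  fix y assume "y \<in> unrolled ?A"
  then obtain x l where y: "y = x + real l" "x \<in> ?A" by (auto simp: unrolled_def)
  from y(2) show "y \<in> ?C ` half_grid D"
  proof
    assume "x \<in> (\<lambda>k. real k / real M) ` {..<M}"
    then obtain k where "x = real k / real M" by auto
    then have "y = ?C (2 * (k + l * M))" using y M by (simp add: field_simps)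
    then show ?thesis by (rule image_eqI) (simp add: half_grid_def)
  next
    assume "x \<in> (\<lambda>q. real (2 * q + 1) / real (2 * M)) ` ({q. q < M} \<inter> D)"
    then obtain q where "x = real (2 * q + 1) / real (2 * M)" "q \<in> D" by auto
    then have "q + l * M \<in> D" "y = ?C (2 * (q + l * M) + 1)"
      using y M by (simp add: per, simp add: field_simps)
    then show ?thesis by (intro image_eqI[of _ _ "2 * (q + l * M) + 1"]) (auto simp: half_grid_def)
  qed
next
  fix y assume "y \<in> ?C ` half_grid D"
  then obtain c where c: "y = ?C c" "c \<in> half_grid D" by auto
  define q l where "q = c div 2 mod M" "l = c div 2 div M"
  have ql: "c div 2 = q + l * M" "q < M" using M by (auto simp: q_l_def)
  show "y \<in> unrolled ?A"
  proof (cases "even c")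
    case True
    then have "c = 2 * (q + l * M)" using ql(1) by (metis dvd_mult_div_cancel)
    then have "y = real q / real M + real l" using c M by (simp add: field_simps)
    moreover have "real q / real M \<in> ?A" using ql by auto
    ultimately show ?thesis unfolding unrolled_def by blast
  next
    case False
    then have "c = 2 * (q + l * M) + 1" using ql(1) by (metis odd_two_times_div_two_succ)
    then have "y = real (2 * q + 1) / real (2 * M) + real l" using c M by (simp add: field_simps)
    moreover have "q \<in> D" using c False ql per by (simp add: half_grid_def)
    then have "real (2 * q + 1) / real (2 * M) \<in> ?A" using ql by auto
    ultimately show ?thesis unfolding unrolled_def by blast
  qed
qed

lemma portion_sizes_bisecting_stage:
  assumes st: "bisecting_stage a m p \<sigma> \<tau>" and ij: "i < p" "j < m"
    and n: "n = m * p + (i * m + j)" and r: "1 \<le> r" "r \<le> p"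
  shows "portion_size a n ` portions r (length (pieces a n)) =
    (\<lambda>d. real d / real (2 * (m * p))) `
      gaps r (half_grid (bisected m p (\<sigma> ` {..<i}) (\<sigma> i) (\<tau> ` {..<j})))"
proof -
  define M where "M = m * p"
  define D where "D = bisected m p (\<sigma> ` {..<i}) (\<sigma> i) (\<tau> ` {..<j})"
  define A where "A = (\<lambda>k. real k / real M) ` {..<M} \<union>
      (\<lambda>q. real (2 * q + 1) / real (2 * M)) ` ({q. q < M} \<inter> D)"
  have M: "0 < M" using ij by (simp add: M_def)
  have \<sigma>: "\<sigma> ` {..<p} \<subseteq> {..<p}" and \<tau>: "bij_betw \<tau> {..<m} {..<m}"
    and first: "a ` {1..M} = (\<lambda>k. real k / real M) ` {..<M}"
    and cut: "\<And>i j. i < p \<Longrightarrow> j < m \<Longrightarrow> a (M + (i * m + j) + 1) =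
       real (2 * (\<tau> j * p + \<sigma> i) + 1) / real (2 * M)"
    using st unfolding bisecting_stage_def M_def by auto
  have "{1..n} = {1..M} \<union> (\<lambda>l. M + l + 1) ` {..<i * m + j}"
  proof (intro equalityI subsetI)
    fix x assume x: "x \<in> {1..n}"
    show "x \<in> {1..M} \<union> (\<lambda>l. M + l + 1) ` {..<i * m + j}"
    proof (cases "x \<le> M")
      case False
      then have "x = M + (x - M - 1) + 1" "x - M - 1 < i * m + j"
        using x by (auto simp: n M_def[symmetric])
      then show ?thesis by blast
    qed (use x in simp)
  qed (auto simp: n M_def)
  then have "a ` {1..n} = a ` {1..M} \<union> (\<lambda>l. a (M + l + 1)) ` {..<i * m + j}"
    by (simp add: image_Un image_image)
  also have "(\<lambda>l. a (M + l + 1)) ` {..<i * m + j} =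
      (\<lambda>(i, j). a (M + (i * m + j) + 1)) ` ({..<i} \<times> {..<m}) \<union>
      (\<lambda>j. a (M + (i * m + j) + 1)) ` {..<j}"
    unfolding lessThan_mult_add image_Un image_image by (simp add: case_prod_beta)
  also have "\<dots> = (\<lambda>(i, j). real (2 * (\<tau> j * p + \<sigma> i) + 1) / real (2 * M)) ` ({..<i} \<times> {..<m}) \<union>
      (\<lambda>j. real (2 * (\<tau> j * p + \<sigma> i) + 1) / real (2 * M)) ` {..<j}"
    using ij by (intro arg_cong2[of _ _ _ _ "(\<union>)"] image_cong) (auto simp: cut[simplified])
  also have "\<dots> = (\<lambda>q. real (2 * q + 1) / real (2 * M)) ` ({q. q < M} \<inter> D)"
    unfolding D_def M_def bisected_lessThan[OF \<sigma> \<tau> ij] image_Un image_image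
    by (simp add: case_prod_beta)
  finally have img: "a ` {1..n} = A" unfolding first A_def .
  \<comment> \<open>All these cuts already lie in the interval from 0 to 1, so \<open>frac\<close>
    changes nothing.\<close>
  have "frac x = x" if "x \<in> A" for x
  proof -
    have "real (2 * q + 1) < real (2 * M)" if "q < M" for q using that by linarith
    then have "0 \<le> x \<and> x < 1" using that M by (auto simp: A_def)
    then show ?thesis by (simp add: frac_eq)
  qed
  then have A: "(\<lambda>i. frac (a i)) ` {1..n} = A"
    using img by (metis (mono_tags, lifting) image_cong image_ident image_image)
  have "r \<le> M" using r ij mult_le_mono[of 1 m r p] by (simp add: M_def)
  also have "M = card ((\<lambda>k. real k / real M) ` {..<M})"
    using M by (subst card_image) (auto simp: inj_on_def)
  also have "\<dots> \<le> card A" by (intro card_mono) (auto simp: A_def)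
  finally have rA: "r \<le> card A" .
  have per: "q + l * M \<in> D \<longleftrightarrow> q \<in> D" for q l
  proof -
    have eq: "q + l * M = q + (l * m) * p" by (simp add: M_def)
    have "0 < p" using ij by simp
    then have "(q + l * M) mod p = q mod p" "(q + l * M) div p = q div p + l * m"
      unfolding eq by auto
    then show ?thesis by (simp add: D_def bisected_def)
  qed
  show ?thesis
    using portion_sizes_eq[of r a n] unrolled_gaps[OF unrolled_half_grid[OF M per]] r rA M
    by (simp only: A) (simp add: A_def D_def[symmetric] M_def[symmetric])
qed

text \<open>Both orders have visited exactly \<open>j\<close> periods for the current residue, so
  \<open>bisected_shift\<close> applies in both directions and the gap sets coincide.\<close>

lemma mu_upto_bisecting_stage_cong:
  assumes a: "bisecting_stage a m p \<sigma> \<tau>" and b: "bisecting_stage b m p \<sigma> \<tau>'"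
    and ij: "i < p" "j < m" and n: "n = m * p + (i * m + j)" and r: "1 \<le> r" "r \<le> p"
  shows "mu_upto r a n = mu_upto r b n"
proof -
  let ?J = "\<tau> ` {..<j}" and ?J' = "\<tau>' ` {..<j}"
  have \<tau>: "bij_betw \<tau> {..<m} {..<m}" "bij_betw \<tau>' {..<m} {..<m}" and s: "\<sigma> i < p"
    using a b ij by (auto simp: bisecting_stage_def)
  have J: "?J \<subseteq> {..<m}" "?J' \<subseteq> {..<m}"
    using \<tau> ij unfolding bij_betw_def by auto
  have "inj_on \<tau> {..<j}" "inj_on \<tau>' {..<j}"
    using \<tau> ij by (auto simp: bij_betw_def elim!: inj_on_subset)
  then have "card ?J = j" "card ?J' = j" by (simp_all add: card_image)
  then have c: "card ?J = card ?J'" by simp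
  have pm: "0 < p" "0 < m" "1 \<le> p" using ij by auto
  have "gaps r (half_grid (bisected m p (\<sigma> ` {..<i}) (\<sigma> i) ?J)) =
        gaps r (half_grid (bisected m p (\<sigma> ` {..<i}) (\<sigma> i) ?J'))"
    using bisected_shift[OF pm(1,2) s J c] bisected_shift[OF pm(1,2) s J(2,1) c[symmetric]]
    by (intro equalityI gaps_subset[OF r(2) pm(3)])
  then show ?thesis
    unfolding mu_upto_def
    by (simp only: portion_sizes_bisecting_stage[OF a ij n r]
        portion_sizes_bisecting_stage[OF b ij n r])
qed

section \<open>Positions in the list of bisecting cuts\<close>

lemma nth_concat_same_length:
  assumes "\<And>x. x \<in> set xs \<Longrightarrow> length (f x) = m" "i < length xs" "j < m"
  shows "concat (map f xs) ! (i * m + j) = f (xs ! i) ! j"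
  using assms
proof (induction xs arbitrary: i)
  case (Cons x xs)
  then show ?case by (cases i) (auto simp: nth_append add.assoc)
qed simp

lemma bisecting_cuts_nth:
  assumes "i < length \<sigma>" "j < m"
  shows "bisecting_cuts \<sigma> m ! (i * m + j) =
    (real (j * length \<sigma> + \<sigma> ! i) - 1 / 2) / real (m * length \<sigma>)"
  unfolding bisecting_cuts_def
  using assms by (subst nth_concat_same_length[where m = m]) (auto simp del: upt_Suc)

section \<open>Bit reversal and the Van der Corput sequence\<close>

definition bit_reverse :: "nat \<Rightarrow> nat \<Rightarrow> nat" where
  "bit_reverse h l = horner_sum of_bool 2 (map (\<lambda>k. bit l (h - 1 - k)) [0..<h])"

lemma van_der_corput_bit_reverse:
  "l < 2 ^ h \<Longrightarrow> van_der_corput (Suc l) = real (bit_reverse h l) / 2 ^ h"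
  using van_der_corput_scaled[of "Suc l" h] by (simp add: bit_reverse_def field_simps)

lemma phi_bit_reverse:
  assumes "l < 2 ^ h" shows "phi h ! l = bit_reverse h l + 1"
proof -
  have "real (phi h ! l) = real (bit_reverse h l + 1)"
    using phi_nth[of "Suc l" h] van_der_corput_bit_reverse[OF assms] assms by simp
  then show ?thesis by (simp only: of_nat_eq_iff)
qed

lemma length_phi: "length (phi h) = 2 ^ h"
  by (simp add: phi_def del: upt_Suc)

text \<open>Inherited from \<open>recipe_phi\<close>: up to the offset 1,
  \<open>bit_reverse h\<close> lists the entries of a permutation.\<close>

lemma bij_betw_bit_reverse: "bij_betw (bit_reverse h) {..<2 ^ h} {..<2 ^ h}"
proof -
  have "distinct (phi h)" "set (phi h) = {1..2 ^ h}"
    using recipe_phi[of h] by (auto simp: recipe_def permutations_of_set_def)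
  then have "bij_betw (\<lambda>l. phi h ! l) {..<2 ^ h} {1..2 ^ h}"
    using bij_betw_nth[of "phi h" "{..<2 ^ h}" "{1..2 ^ h}"] by (simp add: length_phi)
  then have "bij_betw (\<lambda>l. Suc (bit_reverse h l)) {..<2 ^ h} {1..2 ^ h}"
    by (subst bij_betw_cong[where g = "\<lambda>l. phi h ! l"]) (auto simp: phi_bit_reverse)
  moreover have "bij_betw (\<lambda>x. x - 1) {1..2 ^ h} {..<(2::nat) ^ h}"
    by (rule bij_betwI[where g = Suc]) auto
  ultimately have "bij_betw ((\<lambda>x. x - 1) \<circ> (\<lambda>l. Suc (bit_reverse h l))) {..<2 ^ h} {..<2 ^ h}"
    by (rule bij_betw_trans)
  then show ?thesis by (simp add: o_def)
qed

lemma bit_mult_power_add: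
  fixes b c :: nat
  assumes "c < 2 ^ t"
  shows "bit (b * 2 ^ t + c) k \<longleftrightarrow> (if k < t then bit c k else bit b (k - t))"
proof -
  have "b * 2 ^ t + c = concat_bit t (int c) (int b)"
    using assms take_bit_int_eq_self[of "int c" t]
    by (simp add: concat_bit_eq push_bit_eq_mult)
  then have "bit (int (b * 2 ^ t + c)) k \<longleftrightarrow> (if k < t then bit (int c) k else bit (int b) (k - t))"
    by (simp only: bit_concat_bit_iff) auto
  then show ?thesis by (simp only: bit_of_nat_iff_bit)
qed

text \<open>Reversal exchanges the high and low blocks of bits. For cut number
  \<open>i * 2 ^ t + j\<close> of a stage, the low block \<open>j\<close> thus selects the period
  and the high block \<open>i\<close> the residue.\<close>

lemma bit_reverse_append:
  assumes "c < 2 ^ t"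
  shows "bit_reverse (t + h) (b * 2 ^ t + c) = bit_reverse t c * 2 ^ h + bit_reverse h b"
proof -
  have "[0..<t + h] = [0..<h] @ map (\<lambda>k. h + k) [0..<t]"
    using upt_add_eq_append[of 0 h t] map_add_upt[of h t] by (simp add: add.commute)
  moreover have "map (\<lambda>k. bit (b * 2 ^ t + c) (t + h - 1 - k)) [0..<h] =
      map (\<lambda>k. bit b (h - 1 - k)) [0..<h]"
    by (auto simp: bit_mult_power_add[OF assms] intro!: arg_cong[of _ _ "bit b"])
  moreover have "map (\<lambda>k. bit (b * 2 ^ t + c) (t + h - 1 - (h + k))) [0..<t] =
      map (\<lambda>k. bit c (t - 1 - k)) [0..<t]"
    by (auto simp: bit_mult_power_add[OF assms] intro!: arg_cong[of _ _ "bit c"])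
  ultimately have "map (\<lambda>k. bit (b * 2 ^ t + c) (t + h - 1 - k)) [0..<t + h] =
      map (\<lambda>k. bit b (h - 1 - k)) [0..<h] @ map (\<lambda>k. bit c (t - 1 - k)) [0..<t]"
    by (simp only: map_append map_map o_def)
  then show ?thesis
    unfolding bit_reverse_def by (simp add: horner_sum_append mult.commute)
qed

lemma bisecting_stage_van_der_corput:
  "bisecting_stage van_der_corput (2 ^ t) (2 ^ h) (bit_reverse h) (bit_reverse t)"
proof -
  have first: "van_der_corput ` {1..2 ^ K} = (\<lambda>k. real k / 2 ^ K) ` {..<2 ^ K}" for K
  proof -
    have "{1..(2::nat) ^ K} = Suc ` {..<2 ^ K}" by (simp add: image_Suc_lessThan)
    then have "van_der_corput ` {1..2 ^ K} = (\<lambda>l. van_der_corput (Suc l)) ` {..<2 ^ K}"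
      by (simp add: image_image)
    also have "\<dots> = (\<lambda>l. real (bit_reverse K l) / 2 ^ K) ` {..<2 ^ K}"
      by (auto simp: van_der_corput_bit_reverse)
    also have "\<dots> = (\<lambda>k. real k / 2 ^ K) ` (bit_reverse K ` {..<2 ^ K})"
      by (simp add: image_image)
    finally show ?thesis using bij_betw_bit_reverse[of K] by (simp add: bij_betw_def)
  qed
  have cut: "van_der_corput (2 ^ t * 2 ^ h + (i * 2 ^ t + j) + 1) =
      real (2 * (bit_reverse t j * 2 ^ h + bit_reverse h i) + 1) / real (2 * (2 ^ t * 2 ^ h))"
    if "i < 2 ^ h" "j < 2 ^ t" for i j
  proof -
    define q where "q = i * 2 ^ t + j"
    have "q < Suc i * 2 ^ t" using that by (simp add: q_def)
    also have "\<dots> \<le> 2 ^ h * 2 ^ t" using that by (intro mult_le_mono1) simp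
    finally have q: "q < 2 ^ (t + h)" by (simp add: power_add mult.commute)
    have one: "bit_reverse 1 1 = 1" by (simp add: bit_reverse_def bit_0)
    \<comment> \<open>The leading bit 1 of \<open>2 ^ (t + h) + q\<close> becomes the lowest bit
      after reversal, so the numerator is odd and the cut is a midpoint.\<close>
    have "van_der_corput (Suc (2 ^ (t + h) + q)) =
        real (bit_reverse (t + h + 1) (1 * 2 ^ (t + h) + q)) / 2 ^ (t + h + 1)"
      using q by (subst van_der_corput_bit_reverse[where h = "t + h + 1"]) auto
    also have "\<dots> = real (2 * (bit_reverse t j * 2 ^ h + bit_reverse h i) + 1) / 2 ^ (t + h + 1)"
      unfolding bit_reverse_append[OF q] one
      by (simp add: q_def bit_reverse_append[OF that(2)])
    finally show ?thesis by (simp add: q_def power_add)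
  qed
  show ?thesis
    unfolding bisecting_stage_def using cut first[of "t + h"] bij_betw_bit_reverse
    by (auto simp: power_add bij_betw_def)
qed

section \<open>Stages of a recipe\<close>

text \<open>In the induction step the old cuts are the even multiples of half a piece, and the new
  cuts the odd ones, all of them since \<open>\<sigma>\<close> contains every residue.\<close>

lemma set_cuts_until:
  assumes \<sigma>: "recipe p \<sigma>"
  shows "set (cuts_until \<sigma> t) = (\<lambda>k. real k / real (2 ^ t * p)) ` {..<2 ^ t * p}"
proof (induction t)
  have len: "length \<sigma> = p" "set \<sigma> = {1..p}" "1 \<le> p"
    using \<sigma> by (auto simp: recipe_def permutations_of_set_def distinct_card[symmetric])
  {
    case 0
    show ?case using len by (auto simp: lessThan_atLeast0)
  next
    case (Suc t)
    define M where "M = 2 ^ t * p"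
    have M: "0 < M" using len by (simp add: M_def)
    have cuts: "set (bisecting_cuts \<sigma> (2 ^ t)) =
        (\<Union>s\<in>{1..p}. (\<lambda>j. (real ((j - 1) * p + s) - 1 / 2) / real M) ` {1..2 ^ t})"
      by (simp add: bisecting_cuts_def len M_def atLeastLessThanSuc_atLeastAtMost del: upt_Suc)
    have "set (bisecting_cuts \<sigma> (2 ^ t)) = (\<lambda>q. real (2 * q + 1) / real (2 * M)) ` {..<M}"
      (is "?L = ?R")
    proof (intro equalityI subsetI)
      fix y assume "y \<in> ?L"
      then obtain s j where sj: "s \<in> {1..p}" "j \<in> {1..2 ^ t}"
        "y = (real ((j - 1) * p + s) - 1 / 2) / real M"
        unfolding cuts by blast
      define q where "q = (j - 1) * p + (s - 1)"
      have "q < (j - 1) * p + p" unfolding q_def using sj by (intro add_strict_left_mono) auto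
      also have "\<dots> = Suc (j - 1) * p" by simp
      also have "\<dots> \<le> M" unfolding M_def using sj by (intro mult_le_mono1) auto
      finally have "q < M" .
      moreover have "(j - 1) * p + s = q + 1" using sj by (simp add: q_def)
      then have "y = real (2 * q + 1) / real (2 * M)"
        using sj(3) M by (simp add: field_simps)
      ultimately show "y \<in> ?R" by blast
    next
      fix y assume "y \<in> ?R"
      then obtain q where q: "q < M" "y = real (2 * q + 1) / real (2 * M)" by auto
      define s j where "s = q mod p + 1" and "j = q div p + 1"
      have "s \<in> {1..p}" using len by (simp add: s_def Suc_le_eq)
      moreover have "j \<in> {1..2 ^ t}"
        using q by (simp add: j_def Suc_le_eq less_mult_imp_div_less M_def)
      moreover have "(j - 1) * p + s = q + 1" by (simp add: s_def j_def)
      then have "y = (real ((j - 1) * p + s) - 1 / 2) / real M"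
        using q(2) M by (simp add: field_simps)
      ultimately show "y \<in> ?L" unfolding cuts by blast
    qed
    moreover have "set (cuts_until \<sigma> t) = (\<lambda>k. real (2 * k) / real (2 * M)) ` {..<M}"
      unfolding Suc M_def[symmetric] by simp
    moreover have "{..<2 * M} = (\<lambda>k. 2 * k) ` {..<M} \<union> (\<lambda>q. 2 * q + 1) ` {..<M}"
    proof (intro equalityI subsetI)
      fix c assume "c \<in> {..<2 * M}"
      then have "c div 2 < M" "c = 2 * (c div 2) \<or> c = 2 * (c div 2) + 1" by auto
      then show "c \<in> (\<lambda>k. 2 * k) ` {..<M} \<union> (\<lambda>q. 2 * q + 1) ` {..<M}" by blast
    qed auto
    ultimately show ?case
      by (simp add: M_def[symmetric] mult.assoc image_Un image_image del: of_nat_mult of_nat_add)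
  }
qed

lemma bisecting_stage_recipe_cuts:
  assumes \<sigma>: "recipe p \<sigma>"
  shows "bisecting_stage (recipe_cuts \<sigma>) (2 ^ t) p (\<lambda>i. \<sigma> ! i - 1) (\<lambda>j. j)"
proof -
  have len: "length \<sigma> = p" "set \<sigma> = {1..p}" "1 \<le> p"
    using \<sigma> by (auto simp: recipe_def permutations_of_set_def distinct_card[symmetric])
  have "\<sigma> \<noteq> []" using len by auto
  define M where "M = 2 ^ t * p"
  have "{1..M} = Suc ` {..<M}" by (simp add: image_Suc_lessThan)
  then have "recipe_cuts \<sigma> ` {1..M} = (\<lambda>l. recipe_cuts \<sigma> (Suc l)) ` {..<M}"
    by (simp add: image_image)
  also have "\<dots> = (\<lambda>l. cuts_until \<sigma> t ! l) ` {..<M}"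
    using \<open>\<sigma> \<noteq> []\<close> by (intro image_cong) (auto simp: M_def len recipe_cuts_eq[where t = t])
  also have "\<dots> = set (cuts_until \<sigma> t)"
    by (auto simp: set_conv_nth length_cuts_until M_def len)
  finally have first: "recipe_cuts \<sigma> ` {1..M} = (\<lambda>k. real k / real M) ` {..<M}"
    by (simp add: set_cuts_until[OF \<sigma>] M_def)
  have cut: "recipe_cuts \<sigma> (M + (i * 2 ^ t + j) + 1) =
      real (2 * (j * p + (\<sigma> ! i - 1)) + 1) / real (2 * M)"
    if "i < p" "j < 2 ^ t" for i j
  proof -
    have "i * 2 ^ t + j < Suc i * 2 ^ t" using that by simp
    also have "\<dots> \<le> p * 2 ^ t" using that by (intro mult_le_mono1) simp
    finally have "i * 2 ^ t + j < M" by (simp add: M_def mult.commute)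
    then have "recipe_cuts \<sigma> (M + (i * 2 ^ t + j) + 1) =
        cuts_until \<sigma> (Suc t) ! (M + (i * 2 ^ t + j))"
      using \<open>\<sigma> \<noteq> []\<close> by (subst recipe_cuts_eq[where t = "Suc t"]) (auto simp: M_def len mult.commute)
    also have "\<dots> = (real (j * p + \<sigma> ! i) - 1 / 2) / real M"
      using that by (simp add: nth_append length_cuts_until len M_def bisecting_cuts_nth)
    \<comment> \<open>Recipe entries are at least 1, so truncated subtraction loses nothing in the
      change to counting from 0.\<close>
    also have "\<sigma> ! i = (\<sigma> ! i - 1) + 1" using that len nth_mem[of i \<sigma>] by auto
    also have "(real (j * p + (\<sigma> ! i - 1 + 1)) - 1 / 2) / real M =
        real (2 * (j * p + (\<sigma> ! i - 1)) + 1) / real (2 * M)"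
      by (cases "M = 0") (simp_all add: field_simps)
    finally show ?thesis by simp
  qed
  have "(\<lambda>i. \<sigma> ! i - 1) ` {..<p} \<subseteq> {..<p}"
  proof
    fix x assume "x \<in> (\<lambda>i. \<sigma> ! i - 1) ` {..<p}"
    then obtain i where "i < p" "x = \<sigma> ! i - 1" by auto
    then show "x \<in> {..<p}" using len nth_mem[of i \<sigma>] by auto
  qed
  then show ?thesis
    using first cut unfolding bisecting_stage_def M_def by (simp add: bij_betw_def)
qed

section \<open>Comparison of the two sequences\<close>

lemma dyadic_bracket:
  fixes p n :: nat
  assumes "1 \<le> p" "p \<le> n"
  shows "\<exists>t i j. i < p \<and> j < 2 ^ t \<and> n = 2 ^ t * p + (i * 2 ^ t + j)"
proof -
  \<comment> \<open>Leastness for the upper bound yields the lower one: \<open>t - 1\<close> fails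
    it when \<open>t > 0\<close>, and \<open>p \<le> n\<close> settles \<open>t = 0\<close>. The
    remainder is then split by division by \<open>2 ^ t\<close>.\<close>
  define t where "t = (LEAST t. n < 2 ^ Suc t * p)"
  have "n < 2 ^ Suc n * p"
    using less_exp[of n] assms by (auto intro: less_le_trans[of _ "2 ^ n"] simp: trans_less_add1)
  then have up: "n < 2 ^ Suc t * p"
    unfolding t_def by (rule LeastI)
  have low: "2 ^ t * p \<le> n"
  proof (cases t)
    case (Suc u)
    then have "\<not> n < 2 ^ Suc u * p" unfolding t_def by (metis lessI not_less_Least)
    then show ?thesis using Suc by simp
  qed (use assms in simp)
  define q where "q = n - 2 ^ t * p"
  have "q < p * 2 ^ t" using up low by (simp add: q_def mult.commute)
  then have "q div 2 ^ t < p" by (simp add: less_mult_imp_div_less)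
  moreover have "n = 2 ^ t * p + (q div 2 ^ t * 2 ^ t + q mod 2 ^ t)"
    using low unfolding div_mult_mod_eq q_def by simp
  moreover have "q mod 2 ^ t < 2 ^ t" by simp
  ultimately show ?thesis by blast
qed

theorem proposition2:
  fixes r h :: nat
  assumes "r \<ge> 1" and "real h \<ge> log 2 (real r)"
  shows "mu r van_der_corput = mu_recipe r (phi h)"
proof -
  have "real r \<le> 2 powr real h"
    using assms by (simp add: log_le_iff)
  then have r: "r \<le> 2 ^ h"
    by (simp add: powr_realpow)
  \<comment> \<open>The ratios agree exactly for every \<open>n\<close> from \<open>2 ^ h\<close>
    on, so the upper limits are equal.\<close>
  have "mu_upto r van_der_corput n = mu_upto r (recipe_cuts (phi h)) n" if n: "2 ^ h \<le> n" for n
  proof -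
    obtain t i j where ij: "i < 2 ^ h" "j < 2 ^ t" "n = 2 ^ t * 2 ^ h + (i * 2 ^ t + j)"
      using dyadic_bracket[of "2 ^ h" n] n by auto
    have "bisecting_stage (recipe_cuts (phi h)) (2 ^ t) (2 ^ h) (\<lambda>i. phi h ! i - 1) (\<lambda>j. j)"
      by (rule bisecting_stage_recipe_cuts[OF recipe_phi])
    \<comment> \<open>\<open>bisecting_stage\<close> evaluates its residue order only below
      \<open>2 ^ h\<close>, where \<open>phi_bit_reverse\<close> identifies the two
      functions.\<close>
    moreover have "(\<lambda>i. phi h ! i - 1) ` {..<2 ^ h} = bit_reverse h ` {..<2 ^ h}"
      by (intro image_cong) (auto simp: phi_bit_reverse)
    ultimately have "bisecting_stage (recipe_cuts (phi h)) (2 ^ t) (2 ^ h) (bit_reverse h) (\<lambda>j. j)"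
      by (simp add: bisecting_stage_def phi_bit_reverse)
    with bisecting_stage_van_der_corput show ?thesis
      using ij assms(1) r by (rule mu_upto_bisecting_stage_cong)
  qed
  then show ?thesis
    unfolding mu_recipe_def mu_def by (intro Limsup_eq) (auto simp: eventually_sequentially)
qed

end
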